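(* Suppose that $\{\psi_n\}$ strongly separates $\mathfrak{A}$ from $\mathfrak{B}$. For all $n\in\mathbb{N}$, let $\xi_n$ and $\eta_n$ be statistics (measurable functions of $\mathbb{X}_n$) valued in $\mathfrak{D}$ satisfying $P(\xi_n\in\mathfrak{A}\cup\mathfrak{B},\ \eta_n\in\mathfrak{A}\cup\mathfrak{B})\to1$ as $n\to\infty$. If $\psi_n(\xi_n,\mathbb{X}_n)\leqslant\psi_n(\eta_n,\mathbb{X}_n)$ for all $n$, then $$\liminf_{n\to\infty}\left[P(\xi_n\in\mathfrak{A})-P(\eta_n\in\mathfrak{A})\right]\geqslant0.$$
   Context: Let $(\Omega,\mathfrak{F},P)$ be a probability space. All sets and maps are assumed measurable. For each $n\in\mathbb{N}$, the sample $\mathbb{X}_n$ is a map from $\Omega$ to a space $\mathcal{X}_n$. $\mathfrak{D}$ is a set (the decision space, not depending on $n$), $\mathfrak{A}$ and $\mathfrak{B}$ are subsets of $\mathfrak{D}$, and for each $n$ the objective function $\psi_n$ is a map from $\mathfrak{D}\times\mathcal{X}_n$ to $\mathbb{R}$. We say that $\{\psi_n\}$ strongly separates $\mathfrak{A}$ from $\mathfrak{B}$ if, as $n\to\infty$, $P\left(\sup_{x\in\mathfrak{A}}\psi_n(x,\mathbb{X}_n)<\inf_{y\in\mathfrak{B}}\psi_n(y,\mathbb{X}_n)\right)\to1$. *)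

theory Defs
  imports "HOL-Probability.Probability"
begin

(* Supremum and infimum are taken in the extended reals, so they may be infinite and
   A or B may be empty (sup {} = -\<infinity>, inf {} = \<infinity>).  A set outside the sigma-algebra has
   measure 0 in the library, so convergence to 1 forces the event to be measurable
   for all large n. *)
definition strongly_separates ::
  "'w measure \<Rightarrow> (nat \<Rightarrow> 'w \<Rightarrow> 'x) \<Rightarrow> (nat \<Rightarrow> 'd \<times> 'x \<Rightarrow> real) \<Rightarrow> 'd set \<Rightarrow> 'd set \<Rightarrow> bool"
where
  "strongly_separates M X \<psi> A B \<longleftrightarrow>
     (\<lambda>n. measure M {\<omega> \<in> space M.
        (SUP x\<in>A. ereal (\<psi> n (x, X n \<omega>))) < (INF y\<in>B. ereal (\<psi> n (y, X n \<omega>)))})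
       \<longlonglongrightarrow> 1"

end

theory Submission imports Defs begin

text \<open>
  When the two sets are separated, every point of \<open>A\<close> has a strictly smaller
  objective value than every point of \<open>B\<close>.  So if moreover both statistics lie in \<open>A \<union> B\<close>, then
  \<open>\<eta>\<close> landing in \<open>A\<close> drags \<open>\<xi>\<close>, whose objective value is no larger, into \<open>A\<close> too.  Hence
  \<open>\<eta> \<in> A\<close> implies \<open>\<xi> \<in> A\<close> outside two exceptional events (lemma
  \<open>separated_minimizer_mem\<close>), and the union bound makes the probability of \<open>\<xi> \<in> A\<close> at least
  that of \<open>\<eta> \<in> A\<close> minus the probabilities of the exceptional events (lemma
  \<open>prob_diff_ge_of_implication\<close>).  Both of these tend to zero.
\<close>

text \<open>
  The contrapositive is the natural reading: a point outside \<open>A\<close> must lie in \<open>B\<close>, where the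
  values are at least the infimum, hence above everything attained on \<open>A\<close>.
\<close>

lemma separated_minimizer_mem:
  fixes f :: "'d \<Rightarrow> real"
  assumes sep: "(SUP x\<in>A. ereal (f x)) < (INF y\<in>B. ereal (f y))"
    and le: "f a \<le> f b" and a: "a \<in> A \<union> B" and b: "b \<in> A"
  shows "a \<in> A"
proof (rule ccontr)
  assume "a \<notin> A"
  with a have "a \<in> B" by blast
  have "ereal (f b) \<le> (SUP x\<in>A. ereal (f x))"
    using b by (rule SUP_upper)
  also note sep
  also have "(INF y\<in>B. ereal (f y)) \<le> ereal (f a)"
    using \<open>a \<in> B\<close> by (rule INF_lower)
  finally show False using le by simp
qed

text \<open>
  The union bound applied to the complements of \<open>S\<close> and \<open>G\<close>.  It survives when one of these
  is not an event: such a set has measure \<open>0\<close> by convention, so the right-hand side is at most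
  \<open>-1\<close>.  In this way the bound can be used for each index before it is known whether
  the separation set for that index is measurable.
\<close>

lemma (in prob_space) prob_diff_ge_of_implication:
  assumes E: "E \<in> events" and F: "F \<in> events"
    and sub: "E \<inter> (S \<inter> G) \<subseteq> F"
  shows "prob F - prob E \<ge> prob S + prob G - 2"
proof (cases "S \<in> events \<and> G \<in> events")
  case True
  then have S: "S \<in> events" and G: "G \<in> events" by auto
  have "E \<subseteq> F \<union> ((space M - S) \<union> (space M - G))"
    using sub sets.sets_into_space[OF E] by blast
  then have "prob E \<le> prob (F \<union> ((space M - S) \<union> (space M - G)))"
    using F S G by (intro finite_measure_mono) auto
  also have "\<dots> \<le> prob F + prob ((space M - S) \<union> (space M - G))"
    using F S G by (intro measure_Un_le) auto
  also have "prob ((space M - S) \<union> (space M - G)) \<le> prob (space M - S) + prob (space M - G)"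
    using S G by (intro measure_Un_le) auto
  finally show ?thesis
    using prob_compl[OF S] prob_compl[OF G] by simp
next
  case False
  then have "prob S = 0 \<or> prob G = 0"
    by (auto simp: measure_notin_sets)
  then show ?thesis
    using prob_le_1[of E] prob_le_1[of S] prob_le_1[of G] measure_nonneg[of M F] by linarith
qed

theorem theorem3p1:
  fixes M :: "'w measure"
    and S :: "nat \<Rightarrow> 'x measure"
    and X :: "nat \<Rightarrow> 'w \<Rightarrow> 'x"
    and D :: "'d measure"
    and A B :: "'d set"
    and \<psi> :: "nat \<Rightarrow> 'd \<times> 'x \<Rightarrow> real"
    and \<xi> \<eta> :: "nat \<Rightarrow> 'x \<Rightarrow> 'd"
  assumes "prob_space M"
    and "\<And>n. X n \<in> measurable M (S n)"
    and "A \<in> sets D" and "B \<in> sets D"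
    and "\<And>n. \<psi> n \<in> borel_measurable (D \<Otimes>\<^sub>M S n)"
    and "strongly_separates M X \<psi> A B"
    and "\<And>n. \<xi> n \<in> measurable (S n) D"
    and "\<And>n. \<eta> n \<in> measurable (S n) D"
    and "(\<lambda>n. measure M {\<omega> \<in> space M. \<xi> n (X n \<omega>) \<in> A \<union> B \<and> \<eta> n (X n \<omega>) \<in> A \<union> B})
           \<longlonglongrightarrow> 1"
    and "\<And>n \<omega>. \<omega> \<in> space M \<Longrightarrow>
           \<psi> n (\<xi> n (X n \<omega>), X n \<omega>) \<le> \<psi> n (\<eta> n (X n \<omega>), X n \<omega>)"
  shows "liminf (\<lambda>n. ereal (measure M {\<omega> \<in> space M. \<xi> n (X n \<omega>) \<in> A}
                         - measure M {\<omega> \<in> space M. \<eta> n (X n \<omega>) \<in> A})) \<ge> 0"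
proof -
  interpret prob_space M by fact
  let ?S = "\<lambda>n. {\<omega> \<in> space M.
      (SUP x\<in>A. ereal (\<psi> n (x, X n \<omega>))) < (INF y\<in>B. ereal (\<psi> n (y, X n \<omega>)))}"
  let ?G = "\<lambda>n. {\<omega> \<in> space M. \<xi> n (X n \<omega>) \<in> A \<union> B \<and> \<eta> n (X n \<omega>) \<in> A \<union> B}"
  let ?F = "\<lambda>n. {\<omega> \<in> space M. \<xi> n (X n \<omega>) \<in> A}"
  let ?E = "\<lambda>n. {\<omega> \<in> space M. \<eta> n (X n \<omega>) \<in> A}"
  have event: "{\<omega> \<in> space M. \<zeta> (X n \<omega>) \<in> A} \<in> events" if "\<zeta> \<in> measurable (S n) D" for n \<zeta>
    using measurable_sets[OF measurable_compose[OF assms(2) that] assms(3)]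
    by (simp add: vimage_def Int_def conj_commute)
  have "?E n \<inter> (?S n \<inter> ?G n) \<subseteq> ?F n" for n
  proof
    fix \<omega> assume \<omega>: "\<omega> \<in> ?E n \<inter> (?S n \<inter> ?G n)"
    then have sep: "(SUP x\<in>A. ereal (\<psi> n (x, X n \<omega>))) < (INF y\<in>B. ereal (\<psi> n (y, X n \<omega>)))"
      by blast
    have "\<psi> n (\<xi> n (X n \<omega>), X n \<omega>) \<le> \<psi> n (\<eta> n (X n \<omega>), X n \<omega>)"
      using \<omega> by (intro assms(10)) blast
    with sep have "\<xi> n (X n \<omega>) \<in> A"
      by (rule separated_minimizer_mem) (use \<omega> in blast)+
    with \<omega> show "\<omega> \<in> ?F n" by blast
  qed
  then have bound: "prob (?F n) - prob (?E n) \<ge> prob (?S n) + prob (?G n) - 2" for n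
    by (intro prob_diff_ge_of_implication event assms(7,8))
  have "(\<lambda>n. prob (?S n) + prob (?G n) - 2) \<longlonglongrightarrow> 1 + 1 - 2"
    using assms(6,9) unfolding strongly_separates_def
    by (intro tendsto_diff tendsto_add tendsto_const)
  then have "(\<lambda>n. ereal (prob (?S n) + prob (?G n) - 2)) \<longlonglongrightarrow> 0"
    by (simp add: zero_ereal_def)
  then have "0 = liminf (\<lambda>n. ereal (prob (?S n) + prob (?G n) - 2))"
    by (simp add: lim_imp_Liminf)
  also have "\<dots> \<le> liminf (\<lambda>n. ereal (prob (?F n) - prob (?E n)))"
    by (intro Liminf_mono always_eventually allI) (simp only: ereal_less_eq bound)
  finally show ?thesis .
qed

end
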